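(* Let $u=y-x$, $v=y-\frac x2$ and $$S=\{(x,y)\in\mathbb{R}^2:\ \{u\}+\{v\}>1\}.$$ Then: (i) $\chi_S=\{u\}+\{v\}-\{u+v\}$ almost everywhere; (ii) every horizontal and every vertical line meets $S$ in a set of density exactly $1/2$; (iii) $\mathbf{H}\chi_S=\chi_S-\frac12$, equivalently $\mathbf{H}(2\chi_S-1)=2\chi_S-1$.
   Context: $\{\cdot\}$ denotes the fractional part. The density of a subset $A$ of a line, parametrized by arc length, is $\lim_{R\to\infty}\frac1{2R}|A\cap[-R,R]|$. The double Hilbert transform $\mathbf{H}$ acts on bounded functions that are periodic with respect to a lattice in $\mathbb{R}^2$ through their Fourier series: $\mathbf{H}\big[\sum_\omega c_\omega e^{i\langle\omega,z\rangle}\big]=\sum_\omega\phi(\omega)c_\omega e^{i\langle\omega,z\rangle}$, where $\phi(\omega_1,\omega_2)=-\mathrm{sign}(\omega_1)\,\mathrm{sign}(\omega_2)$; thus $\phi=1$ on the open second and fourth quadrants, $\phi=-1$ on the open first and third quadrants, and $\phi=0$ on the coordinate axes (in particular constants, and functions of one variable alone, are annihilated). The set $S$ is lattice-periodic, since it is invariant under integer shifts of $u$ and of $v$. *)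

theory Defs
  imports "HOL-Analysis.Analysis"
begin

definition has_density :: "real set \<Rightarrow> real \<Rightarrow> bool" where
  "has_density A d \<longleftrightarrow> A \<in> sets lebesgue \<and>
     ((\<lambda>R. measure lebesgue (A \<inter> {-R..R}) / (2 * R)) \<longlongrightarrow> d) at_top"

text \<open>A lattice in the plane is given by a basis \<open>p, q\<close>; the Fourier series of a periodic function
  is indexed by the frequencies \<open>\<omega>\<close> for which \<open>z \<mapsto> exp (\<i> * (\<omega> \<bullet> z))\<close> is periodic.\<close>

definition plane_lattice :: "real \<times> real \<Rightarrow> real \<times> real \<Rightarrow> (real \<times> real) set" where
  "plane_lattice p q = {of_int m *\<^sub>R p + of_int n *\<^sub>R q | (m::int) (n::int). True}"

definition lattice_basis :: "real \<times> real \<Rightarrow> real \<times> real \<Rightarrow> bool" where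
  "lattice_basis p q \<longleftrightarrow> p \<noteq> q \<and> independent {p, q}"

definition lattice_periodic :: "real \<times> real \<Rightarrow> real \<times> real \<Rightarrow> (real \<times> real \<Rightarrow> complex) \<Rightarrow> bool" where
  "lattice_periodic p q f \<longleftrightarrow> (\<forall>w\<in>plane_lattice p q. \<forall>z. f (z + w) = f z)"

definition period_cell :: "real \<times> real \<Rightarrow> real \<times> real \<Rightarrow> (real \<times> real) set" where
  "period_cell p q = {s *\<^sub>R p + t *\<^sub>R q | s t. 0 \<le> s \<and> s < 1 \<and> 0 \<le> t \<and> t < 1}"

definition frequencies :: "real \<times> real \<Rightarrow> real \<times> real \<Rightarrow> (real \<times> real) set" where
  "frequencies p q = {\<omega>. \<forall>w\<in>plane_lattice p q. \<exists>k::int. \<omega> \<bullet> w = 2 * pi * of_int k}"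

definition fourier_coeff ::
    "real \<times> real \<Rightarrow> real \<times> real \<Rightarrow> (real \<times> real \<Rightarrow> complex) \<Rightarrow> real \<times> real \<Rightarrow> complex" where
  "fourier_coeff p q f \<omega> =
     (LINT z:period_cell p q|lebesgue. f z * exp (- \<i> * of_real (\<omega> \<bullet> z)))
       / of_real (measure lebesgue (period_cell p q))"

definition double_hilbert_symbol :: "real \<times> real \<Rightarrow> real" where
  "double_hilbert_symbol \<omega> = - sgn (fst \<omega>) * sgn (snd \<omega>)"

text \<open>\<open>has_double_hilbert p q f g\<close> says that the double Hilbert transform of the bounded function
  \<open>f\<close>, periodic with respect to the lattice with basis \<open>p, q\<close>, is \<open>g\<close>: the Fourier series of
  \<open>f\<close>, multiplied termwise by the symbol, converges to \<open>g\<close> unconditionally in \<open>L\<^sup>2\<close> of a period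
  cell. This determines \<open>g\<close> up to null sets, independently of which period lattice of \<open>f\<close>
  (with \<open>g\<close> periodic for it too) is used. As \<open>g\<close> is measurable, the convergence of the
  extended nonnegative integrals also forces \<open>g\<close> to be square integrable on the cell.\<close>

definition has_double_hilbert ::
    "real \<times> real \<Rightarrow> real \<times> real \<Rightarrow> (real \<times> real \<Rightarrow> complex) \<Rightarrow> (real \<times> real \<Rightarrow> complex) \<Rightarrow> bool" where
  "has_double_hilbert p q f g \<longleftrightarrow>
     lattice_basis p q \<and>
     f \<in> borel_measurable lebesgue \<and> bounded (range f) \<and> lattice_periodic p q f \<and>
     g \<in> borel_measurable lebesgue \<and> lattice_periodic p q g \<and>
     ((\<lambda>F. \<integral>\<^sup>+ z \<in> period_cell p q.
          ennreal ((cmod (g z - (\<Sum>\<omega>\<in>F. of_real (double_hilbert_symbol \<omega>)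
             * fourier_coeff p q f \<omega> * exp (\<i> * of_real (\<omega> \<bullet> z)))))\<^sup>2) \<partial>lebesgue)
        \<longlongrightarrow> 0) (finite_subsets_at_top (frequencies p q))"

definition u_coord :: "real \<times> real \<Rightarrow> real" where
  "u_coord = (\<lambda>(x, y). y - x)"

definition v_coord :: "real \<times> real \<Rightarrow> real" where
  "v_coord = (\<lambda>(x, y). y - x / 2)"

definition S_set :: "(real \<times> real) set" where
  "S_set = {z. frac (u_coord z) + frac (v_coord z) > 1}"

text \<open>Translation by \<open>u_shift\<close> adds \<open>1\<close> to the first of the two coordinates and leaves the second
  unchanged; \<open>v_shift\<close> does the opposite.\<close>

definition u_shift :: "real \<times> real" where "u_shift = (-2, -1)"
definition v_shift :: "real \<times> real" where "v_shift = (2, 2)"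

lemma uv_shift:
  "u_coord (z + u_shift) = u_coord z + 1" "v_coord (z + u_shift) = v_coord z"
  "u_coord (z + v_shift) = u_coord z" "v_coord (z + v_shift) = v_coord z + 1"
  by (cases z; simp add: u_coord_def v_coord_def u_shift_def v_shift_def field_simps)+

end

theory Submission
  imports Defs
begin

text \<open>
  Off the null set where \<open>u + v\<close> is an integer, \<open>\<chi>\<^sub>S = {u} + {v} - {u + v}\<close>. On a horizontal or
  vertical line each of \<open>u\<close>, \<open>v\<close>, \<open>u + v\<close> is a nonconstant affine function, and the fractional
  part of such a function has mean \<open>1/2\<close>; hence the density \<open>1/2 + 1/2 - 1/2\<close>.

  In the coordinates \<open>(u, v)\<close> the set \<open>S\<close> becomes the periodic triangle \<open>s + t > 1\<close> in the unit
  square. Apart from the constant term, its Fourier coefficients live on the frequencies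
  \<open>(m, 0)\<close>, \<open>(0, n)\<close>, \<open>(n, n)\<close>, that is, on multiples of \<open>u\<close>, \<open>v\<close>, \<open>u + v\<close>, all of which lie in the
  open second and fourth quadrants of the \<open>(x, y)\<close>-frequency plane, where the symbol is \<open>1\<close>. So
  the multiplier only removes the mean. Since \<open>\<chi>\<^sub>S - 1/2\<close> has constant modulus \<open>1/2\<close>, convergence
  in \<open>L\<^sup>2\<close> amounts to the Parseval identity \<open>1/4 = 3 \<cdot> 2 \<zeta>(2) / (4 \<pi>\<^sup>2)\<close>.
\<close>

subsection \<open>Densities along lines\<close>

text \<open>The right-hand side is the carry when the two fractional parts are added: 0 if their sum
  is below 1, and 1 otherwise. The strict inequality misreports the carry only when the sum is
  exactly 1, and then \<open>x + y\<close> is an integer.\<close>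

lemma indicator_frac_add_gt_1:
  fixes x y :: real
  assumes "x + y \<notin> \<int>"
  shows "of_bool (frac x + frac y > 1) = frac x + frac y - frac (x + y)"
proof -
  have "frac x + frac y \<noteq> 1"
    using assms frac_add[of x y] by (auto simp flip: frac_eq_0_iff)
  then show ?thesis
    by (simp add: frac_add)
qed

text \<open>A continuous primitive of \<^const>\<open>frac\<close> that stays within bounded distance of \<open>x / 2\<close>.\<close>

definition frac_primitive :: "real \<Rightarrow> real" where
  "frac_primitive x = (x - frac x + (frac x)\<^sup>2) / 2"

text \<open>With \<open>f = frac x\<close>, the deviation from \<open>x / 2\<close> is
  \<open>- (f - f^2) / 2\<close>, and \<open>0 \<le> f - f^2 \<le> 1\<close>. The constant is far
  from sharp; only boundedness matters.\<close>

lemma frac_primitive_bounds: "x / 2 - 1 \<le> frac_primitive x" "frac_primitive x \<le> x / 2"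
proof -
  define f g where "f = frac x" and "g = f\<^sup>2"
  have "0 \<le> f" "f < 1" by (auto simp: f_def frac_lt_1)
  moreover have "0 \<le> g" by (simp add: g_def)
  moreover have "g \<le> f"
    using calculation by (simp add: f_def g_def power2_eq_square mult_left_le)
  ultimately show "x / 2 - 1 \<le> frac_primitive x" "frac_primitive x \<le> x / 2"
    by (simp_all add: frac_primitive_def flip: f_def g_def)
qed

lemma continuous_on_frac_primitive_unit:
  "continuous_on {of_int n..of_int n + 1} frac_primitive"
proof (rule continuous_on_eq)
  show "continuous_on {of_int n..of_int n + 1} (\<lambda>x. (of_int n + (x - of_int n)\<^sup>2) / 2 :: real)"
    by (intro continuous_intros) auto
  fix x :: real assume x: "x \<in> {of_int n..of_int n + 1}"
  show "(of_int n + (x - of_int n)\<^sup>2) / 2 = frac_primitive x"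
  proof (cases "x = of_int n + 1")
    \<comment> \<open>At the right endpoint the floor has already jumped to \<open>n + 1\<close>,
      but both formulas give \<open>(n + 1) / 2\<close>. This is why the quadratic pieces glue
      continuously.\<close>
    case True
    then have "frac x = 0" by simp
    then show ?thesis using True by (simp add: frac_primitive_def)
  next
    case False
    with x have "\<lfloor>x\<rfloor> = n" by (intro floor_unique) auto
    then show ?thesis by (simp add: frac_primitive_def frac_def)
  qed
qed

lemma isCont_frac_primitive: "isCont frac_primitive x"
proof -
  define n where "n = \<lfloor>x\<rfloor>"
  \<comment> \<open>Two adjacent unit intervals are taken because \<open>x\<close> may itself be an
    integer, hence an endpoint of \<open>[n, n + 1]\<close>.\<close>
  let ?I = "{of_int (n - 1)..of_int (n - 1) + 1} \<union> {of_int n..of_int n + 1} :: real set"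
  have "continuous_on ?I frac_primitive"
    by (intro continuous_on_closed_Un continuous_on_frac_primitive_unit) auto
  moreover have "?I = {of_int n - 1..of_int n + 1}" by auto
  moreover have "x \<in> interior {of_int n - 1..of_int n + 1 :: real}"
    unfolding n_def interior_atLeastAtMost_real greaterThanLessThan_iff by linarith
  ultimately show ?thesis
    using continuous_on_interior by metis
qed

lemma has_real_derivative_frac_primitive:
  assumes "x \<notin> \<int>"
  shows "(frac_primitive has_real_derivative frac x) (at x)"
proof -
  have "((\<lambda>y. real_of_int \<lfloor>y\<rfloor>) has_real_derivative 0) (at x)"
    using floor_has_real_derivative[where f = "\<lambda>y. y" and x = x] assms by simp
  then have "(frac has_real_derivative 1) (at x)"
    unfolding frac_def[abs_def] by (auto intro!: derivative_eq_intros)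
  then have "((\<lambda>y. (y - frac y + (frac y)\<^sup>2) / 2) has_real_derivative frac x) (at x)"
    by (auto intro!: derivative_eq_intros)
  then show ?thesis
    by (simp add: frac_primitive_def[abs_def])
qed

text \<open>Fundamental theorem of calculus for a primitive that is continuous everywhere and
  differentiable except where the affine argument is an integer.\<close>

lemma has_integral_frac_affine:
  fixes \<alpha> \<beta> :: real
  assumes "\<alpha> \<noteq> 0" "a \<le> b"
  shows "((\<lambda>t. frac (\<alpha> * t + \<beta>)) has_integral
    (frac_primitive (\<alpha> * b + \<beta>) / \<alpha> - frac_primitive (\<alpha> * a + \<beta>) / \<alpha>)) {a..b}"
\<comment> \<open>The exceptional set has to be finite, so only integers in a bounded range are
  pulled back. The range suffices because
  \<open>\<bar>t\<bar> \<le> \<bar>a\<bar> + \<bar>b\<bar>\<close> on the interval.\<close>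
proof (rule fundamental_theorem_of_calculus_interior_strong[where
    S = "(\<lambda>k. (of_int k - \<beta>) / \<alpha>) ` {\<lfloor>- (\<bar>\<alpha>\<bar> * (\<bar>a\<bar> + \<bar>b\<bar>)) + \<beta>\<rfloor>..\<lceil>\<bar>\<alpha>\<bar> * (\<bar>a\<bar> + \<bar>b\<bar>) + \<beta>\<rceil>}"])
  fix t assume t: "t \<in> {a<..<b} - (\<lambda>k. (of_int k - \<beta>) / \<alpha>) `
     {\<lfloor>- (\<bar>\<alpha>\<bar> * (\<bar>a\<bar> + \<bar>b\<bar>)) + \<beta>\<rfloor>..\<lceil>\<bar>\<alpha>\<bar> * (\<bar>a\<bar> + \<bar>b\<bar>) + \<beta>\<rceil>}"
  have "\<alpha> * t + \<beta> \<notin> \<int>"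
  proof
    assume "\<alpha> * t + \<beta> \<in> \<int>"
    then obtain k where k: "\<alpha> * t + \<beta> = of_int k" by (auto elim: Ints_cases)
    have "\<bar>\<alpha> * t\<bar> \<le> \<bar>\<alpha>\<bar> * (\<bar>a\<bar> + \<bar>b\<bar>)"
      unfolding abs_mult using t by (intro mult_left_mono) auto
    then have "\<lfloor>- (\<bar>\<alpha>\<bar> * (\<bar>a\<bar> + \<bar>b\<bar>)) + \<beta>\<rfloor> \<le> k" "k \<le> \<lceil>\<bar>\<alpha>\<bar> * (\<bar>a\<bar> + \<bar>b\<bar>) + \<beta>\<rceil>"
      using k by linarith+
    moreover have "t = (of_int k - \<beta>) / \<alpha>"
      using k assms(1) by (simp add: field_simps)
    ultimately show False using t by auto
  qed
  then have "((\<lambda>t. frac_primitive (\<alpha> * t + \<beta>) / \<alpha>) has_real_derivative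
      frac (\<alpha> * t + \<beta>) * \<alpha> / \<alpha>) (at t)"
    by (intro DERIV_cdivide DERIV_chain2[where g = "\<lambda>t. \<alpha> * t + \<beta>"] has_real_derivative_frac_primitive)
      (auto intro!: derivative_eq_intros)
  then show "((\<lambda>t. frac_primitive (\<alpha> * t + \<beta>) / \<alpha>) has_vector_derivative frac (\<alpha> * t + \<beta>)) (at t)"
    using assms(1) by (simp add: has_real_derivative_iff_has_vector_derivative)
next
  show "continuous_on {a..b} (\<lambda>t. frac_primitive (\<alpha> * t + \<beta>) / \<alpha>)"
    by (intro continuous_at_imp_continuous_on ballI continuous_divide
        continuous_within_compose3[OF isCont_frac_primitive] continuous_intros) (use assms in auto)
qed (use assms in auto)

text \<open>Replacing the primitive by \<open>x / 2\<close> in the integral formula costs a bounded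
  error, so the integral over \<open>[-R, R]\<close> is \<open>R + O(1)\<close>.\<close>

lemma frac_affine_mean:
  fixes \<alpha> \<beta> :: real
  assumes "\<alpha> \<noteq> 0"
  shows "((\<lambda>R. integral {-R..R} (\<lambda>t. frac (\<alpha> * t + \<beta>)) / (2 * R)) \<longlongrightarrow> 1 / 2) at_top"
proof -
  have bd: "\<bar>integral {-R..R} (\<lambda>t. frac (\<alpha> * t + \<beta>)) / (2 * R) - 1 / 2\<bar> \<le> (1 / \<bar>\<alpha>\<bar>) / R"
    if "R > 0" for R
  proof -
    \<comment> \<open>The error of the primitive's increment against its main term
      \<open>\<alpha> * R\<close>; the offset \<open>\<beta>\<close> cancels between the two
      ends.\<close>
    let ?d = "frac_primitive (\<alpha> * R + \<beta>) - frac_primitive (\<alpha> * (-R) + \<beta>) - \<alpha> * R"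
    have "integral {-R..R} (\<lambda>t. frac (\<alpha> * t + \<beta>)) =
        frac_primitive (\<alpha> * R + \<beta>) / \<alpha> - frac_primitive (\<alpha> * (-R) + \<beta>) / \<alpha>"
      by (intro integral_unique has_integral_frac_affine) (use that assms in auto)
    then have "integral {-R..R} (\<lambda>t. frac (\<alpha> * t + \<beta>)) = ?d / \<alpha> + R"
      using assms by (simp add: diff_divide_distrib)
    then have "integral {-R..R} (\<lambda>t. frac (\<alpha> * t + \<beta>)) / (2 * R) - 1 / 2 = ?d / (2 * \<alpha> * R)"
      using that assms by (simp add: add_divide_distrib)
    also have "\<bar>\<dots>\<bar> = \<bar>?d\<bar> / (2 * \<bar>\<alpha>\<bar> * R)"
      using that by (simp add: abs_mult)
    also have "\<dots> \<le> 2 / (2 * \<bar>\<alpha>\<bar> * R)"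
    proof (rule divide_right_mono)
      show "\<bar>?d\<bar> \<le> 2"
        using frac_primitive_bounds[of "\<alpha> * R + \<beta>"] frac_primitive_bounds[of "\<alpha> * (-R) + \<beta>"]
        by (auto simp: field_simps)
    qed (use that in auto)
    finally show ?thesis
      by simp
  qed
  have "((\<lambda>R. integral {-R..R} (\<lambda>t. frac (\<alpha> * t + \<beta>)) / (2 * R) - 1 / 2) \<longlongrightarrow> 0) at_top"
  proof (rule Lim_null_comparison)
    show "\<forall>\<^sub>F R in at_top. norm (integral {-R..R} (\<lambda>t. frac (\<alpha> * t + \<beta>)) / (2 * R) - 1 / 2)
        \<le> (1 / \<bar>\<alpha>\<bar>) / R"
      using eventually_gt_at_top[of 0] by eventually_elim (use bd in auto)
    show "((\<lambda>R. (1 / \<bar>\<alpha>\<bar>) / R) \<longlongrightarrow> 0) at_top"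
      by (intro real_tendsto_divide_at_top[OF tendsto_const] filterlim_ident)
  qed
  then show ?thesis
    by (simp add: LIM_zero_iff)
qed

lemma borel_measurable_frac [measurable]: "frac \<in> borel_measurable (borel :: real measure)"
  unfolding frac_def[abs_def] by measurable

text \<open>The carry identity writes the indicator as a combination of three fractional parts of
  affine functions. The three hypotheses make each of them nonconstant, so each has mean
  \<open>1/2\<close>.\<close>

lemma has_density_frac_affine_add_gt_1:
  fixes \<alpha> \<beta> \<gamma> \<delta> :: real
  assumes "\<alpha> \<noteq> 0" "\<gamma> \<noteq> 0" "\<alpha> + \<gamma> \<noteq> 0"
  shows "has_density {t. frac (\<alpha> * t + \<beta>) + frac (\<gamma> * t + \<delta>) > 1} (1 / 2)"
proof -
  define A where "A = {t. frac (\<alpha> * t + \<beta>) + frac (\<gamma> * t + \<delta>) > 1}"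
  define I where "I \<alpha> \<beta> R = integral {-R..R} (\<lambda>t. frac (\<alpha> * t + \<beta>))" for \<alpha> \<beta> R :: real
  have A: "A \<in> sets borel" unfolding A_def by measurable
  \<comment> \<open>The carry identity can fail only where the summed affine function is an integer.
    Its slope \<open>\<alpha> + \<gamma>\<close> is nonzero, so these points are countable.\<close>
  have null: "negligible {t. (\<alpha> + \<gamma>) * t + (\<beta> + \<delta>) \<in> \<int>}"
    unfolding negligible_iff_null_sets
  proof (intro null_sets_completionI countable_imp_null_set_lborel, rule countable_subset)
    show "{t. (\<alpha> + \<gamma>) * t + (\<beta> + \<delta>) \<in> \<int>} \<subseteq> (\<lambda>k. (of_int k - (\<beta> + \<delta>)) / (\<alpha> + \<gamma>)) ` UNIV"
    proof
      fix t assume "t \<in> {t. (\<alpha> + \<gamma>) * t + (\<beta> + \<delta>) \<in> \<int>}"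
      then obtain k where "(\<alpha> + \<gamma>) * t + (\<beta> + \<delta>) = of_int k" by (auto elim: Ints_cases)
      then have "t = (of_int k - (\<beta> + \<delta>)) / (\<alpha> + \<gamma>)"
        using assms(3) by (metis add_diff_cancel_right' nonzero_mult_div_cancel_left)
      then show "t \<in> (\<lambda>k. (of_int k - (\<beta> + \<delta>)) / (\<alpha> + \<gamma>)) ` UNIV" by blast
    qed
  qed simp
  have eq: "measure lebesgue (A \<inter> {-R..R}) = I \<alpha> \<beta> R + I \<gamma> \<delta> R - I (\<alpha> + \<gamma>) (\<beta> + \<delta>) R" if "R > 0" for R
  proof -
    have int: "((\<lambda>t. frac (\<alpha> * t + \<beta>)) has_integral I \<alpha> \<beta> R) {-R..R}" if "\<alpha> \<noteq> 0" for \<alpha> \<beta>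
      unfolding I_def has_integral_integral[symmetric]
      using has_integral_frac_affine[of \<alpha> "-R" R \<beta>] that \<open>R > 0\<close> by (auto simp: integrable_on_def)
    have "((\<lambda>t. frac (\<alpha> * t + \<beta>) + frac (\<gamma> * t + \<delta>) - frac ((\<alpha> + \<gamma>) * t + (\<beta> + \<delta>)))
       has_integral (I \<alpha> \<beta> R + I \<gamma> \<delta> R - I (\<alpha> + \<gamma>) (\<beta> + \<delta>) R)) {-R..R}"
      by (intro has_integral_diff has_integral_add int assms)
    then have "(indicat_real A has_integral (I \<alpha> \<beta> R + I \<gamma> \<delta> R - I (\<alpha> + \<gamma>) (\<beta> + \<delta>) R)) {-R..R}"
    proof (rule has_integral_spike[OF null, rotated])
      fix t assume "t \<in> {-R..R} - {t. (\<alpha> + \<gamma>) * t + (\<beta> + \<delta>) \<in> \<int>}"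
      moreover have sum_eq: "(\<alpha> + \<gamma>) * t + (\<beta> + \<delta>) = (\<alpha> * t + \<beta>) + (\<gamma> * t + \<delta>)"
        by (simp add: algebra_simps)
      ultimately have "(\<alpha> * t + \<beta>) + (\<gamma> * t + \<delta>) \<notin> \<int>" by simp
      from indicator_frac_add_gt_1[OF this]
      show "indicat_real A t =
          frac (\<alpha> * t + \<beta>) + frac (\<gamma> * t + \<delta>) - frac ((\<alpha> + \<gamma>) * t + (\<beta> + \<delta>))"
        unfolding sum_eq by (simp add: A_def indicator_def)
    qed
    then have "((\<lambda>t. if t \<in> {-R..R} then indicat_real A t else 0) has_integral
        (I \<alpha> \<beta> R + I \<gamma> \<delta> R - I (\<alpha> + \<gamma>) (\<beta> + \<delta>) R)) UNIV"
      by (subst has_integral_restrict_UNIV)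
    moreover have "(\<lambda>t. if t \<in> {-R..R} then indicat_real A t else 0) = indicat_real (A \<inter> {-R..R})"
      by (auto simp: indicator_def)
    ultimately show ?thesis
      using lmeasurable_iff_indicator_has_integral[of "A \<inter> {-R..R}"] by metis
  qed
  have "((\<lambda>R. I \<alpha> \<beta> R / (2 * R) + I \<gamma> \<delta> R / (2 * R) - I (\<alpha> + \<gamma>) (\<beta> + \<delta>) R / (2 * R))
      \<longlongrightarrow> 1 / 2 + 1 / 2 - 1 / 2) at_top"
    unfolding I_def by (intro tendsto_intros frac_affine_mean assms)
  moreover have "\<forall>\<^sub>F R in at_top. I \<alpha> \<beta> R / (2 * R) + I \<gamma> \<delta> R / (2 * R)
      - I (\<alpha> + \<gamma>) (\<beta> + \<delta>) R / (2 * R) = measure lebesgue (A \<inter> {-R..R}) / (2 * R)"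
    using eventually_gt_at_top[of 0] by eventually_elim (simp add: eq add_divide_distrib diff_divide_distrib)
  ultimately have "((\<lambda>R. measure lebesgue (A \<inter> {-R..R}) / (2 * R)) \<longlongrightarrow> 1 / 2) at_top"
    using tendsto_cong by fastforce
  then show ?thesis
    using A by (auto simp: has_density_def A_def[symmetric])
qed

text \<open>Along a horizontal line \<open>u\<close>, \<open>v\<close> and \<open>u + v\<close> have
  slopes \<open>-1\<close>, \<open>-1/2\<close> and \<open>-3/2\<close>, none of them zero.\<close>

lemma has_density_S_set_horizontal: "has_density {t. (a + t, b) \<in> S_set} (1 / 2)"
proof -
  have "{t. (a + t, b) \<in> S_set} = {t. frac ((-1) * t + (b - a)) + frac ((-1/2) * t + (b - a / 2)) > 1}"
    by (simp add: S_set_def u_coord_def v_coord_def diff_divide_distrib add_divide_distrib algebra_simps)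
  then show ?thesis
    by (simp only:) (rule has_density_frac_affine_add_gt_1; simp)
qed

text \<open>Along a vertical line the slopes of \<open>u\<close>, \<open>v\<close> and
  \<open>u + v\<close> are \<open>1\<close>, \<open>1\<close> and \<open>2\<close>.\<close>

lemma has_density_S_set_vertical: "has_density {t. (a, b + t) \<in> S_set} (1 / 2)"
proof -
  have "{t. (a, b + t) \<in> S_set} = {t. frac (1 * t + (b - a)) + frac (1 * t + (b - a / 2)) > 1}"
    by (simp add: S_set_def u_coord_def v_coord_def diff_divide_distrib add_divide_distrib algebra_simps)
  then show ?thesis
    by (simp only:) (rule has_density_frac_affine_add_gt_1; simp)
qed

section \<open>The almost everywhere formula for the indicator of \<open>S_set\<close>\<close>

lemma AE_indicator_S_set:
  "AE z in lebesgue. (indicator S_set z :: real)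
     = frac (u_coord z) + frac (v_coord z) - frac (u_coord z + v_coord z)"
proof -
  \<comment> \<open>The vector \<open>(-3/2, 2)\<close> is the gradient of \<open>u + v\<close>. The
    exceptional set is thus a countable family of parallel lines.\<close>
  have "negligible (\<Union>k::int. {z :: real \<times> real. (-3/2, 2) \<bullet> z = of_int k})"
    by (intro negligible_countable_Union) (auto intro!: negligible_hyperplane simp: zero_prod_def)
  then have "AE z in lebesgue. z \<notin> (\<Union>k::int. {z :: real \<times> real. (-3/2, 2) \<bullet> z = of_int k})"
    unfolding negligible_iff_null_sets by (rule AE_not_in)
  then show ?thesis
  proof eventually_elim
    case (elim z)
    have "u_coord z + v_coord z = (-3/2, 2) \<bullet> z"
      by (cases z) (simp add: u_coord_def v_coord_def field_simps)
    with elim have "u_coord z + v_coord z \<notin> \<int>"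
      by (auto elim!: Ints_cases)
    from indicator_frac_add_gt_1[OF this] show ?case
      by (simp add: S_set_def indicator_def)
  qed
qed

subsection \<open>Change of variables to the unit square\<close>

text \<open>The inverse of \<open>z \<mapsto> (u_coord z, v_coord z)\<close>: it takes a coordinate
  pair to the point of the plane and the unit square onto the period cell.\<close>

abbreviation lattice_coords :: "real \<times> real \<Rightarrow> real \<times> real" where
  "lattice_coords w \<equiv> fst w *\<^sub>R u_shift + snd w *\<^sub>R v_shift"

lemma lattice_coords_eq: "lattice_coords w = (2 * snd w - 2 * fst w, 2 * snd w - fst w)"
  by (simp add: u_shift_def v_shift_def)

lemma u_coord_lattice_coords [simp]: "u_coord (lattice_coords w) = fst w"
  and v_coord_lattice_coords [simp]: "v_coord (lattice_coords w) = snd w"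
  by (simp_all add: lattice_coords_eq u_coord_def v_coord_def field_simps)

lemma borel_measurable_uv_coord [measurable]:
  "u_coord \<in> borel_measurable borel" "v_coord \<in> borel_measurable borel"
  unfolding u_coord_def v_coord_def borel_prod[symmetric] by measurable

lemma borel_measurable_lattice_coords [measurable]: "lattice_coords \<in> borel_measurable borel"
  by (intro borel_measurable_continuous_onI continuous_intros)

text \<open>The linear map has determinant of modulus 2. The substitution is split into two
  one-dimensional ones, \<open>x = y - s\<close> for fixed \<open>y\<close> and then, after
  exchanging the integrals, \<open>y = 2 * t - s\<close> for fixed \<open>s\<close>; the second
  contributes the factor 2.\<close>

lemma nn_integral_lborel_lattice_coords:
  fixes F :: "real \<times> real \<Rightarrow> ennreal"
  assumes [measurable]: "F \<in> borel_measurable borel"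
  shows "(\<integral>\<^sup>+z. F z \<partial>lborel) = 2 * (\<integral>\<^sup>+w. F (lattice_coords w) \<partial>lborel)"
proof -
  have [measurable]: "F \<in> borel_measurable (borel \<Otimes>\<^sub>M borel)"
    by (simp add: borel_prod)
  have "(\<integral>\<^sup>+z. F z \<partial>lborel) = (\<integral>\<^sup>+z. F z \<partial>(lborel \<Otimes>\<^sub>M lborel))"
    by (simp add: lborel_prod)
  also have "\<dots> = (\<integral>\<^sup>+y. \<integral>\<^sup>+x. F (x, y) \<partial>lborel \<partial>lborel)"
    by (rule lborel_pair.nn_integral_snd[symmetric]) measurable
  also have "\<dots> = (\<integral>\<^sup>+y. \<integral>\<^sup>+s. F (y - s, y) \<partial>lborel \<partial>lborel)"
  proof (rule nn_integral_cong)
    fix y :: real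
    show "(\<integral>\<^sup>+x. F (x, y) \<partial>lborel) = (\<integral>\<^sup>+s. F (y - s, y) \<partial>lborel)"
      by (subst nn_integral_real_affine[of "\<lambda>x. F (x, y)" "-1" y]) simp_all
  qed
  also have "\<dots> = (\<integral>\<^sup>+s. \<integral>\<^sup>+y. F (y - s, y) \<partial>lborel \<partial>lborel)"
    by (rule lborel_pair.Fubini') measurable
  also have "\<dots> = (\<integral>\<^sup>+s. 2 * (\<integral>\<^sup>+t. F (2 * t - 2 * s, 2 * t - s) \<partial>lborel) \<partial>lborel)"
  proof (rule nn_integral_cong)
    fix s :: real
    show "(\<integral>\<^sup>+y. F (y - s, y) \<partial>lborel) = 2 * (\<integral>\<^sup>+t. F (2 * t - 2 * s, 2 * t - s) \<partial>lborel)"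
      by (subst nn_integral_real_affine[of "\<lambda>y. F (y - s, y)" 2 "- s"]) (simp_all add: algebra_simps)
  qed
  also have "\<dots> = 2 * (\<integral>\<^sup>+s. \<integral>\<^sup>+t. F (2 * t - 2 * s, 2 * t - s) \<partial>lborel \<partial>lborel)"
    by (rule nn_integral_cmult) measurable
  also have "(\<integral>\<^sup>+s. \<integral>\<^sup>+t. F (2 * t - 2 * s, 2 * t - s) \<partial>lborel \<partial>lborel) =
      (\<integral>\<^sup>+s. \<integral>\<^sup>+t. F (lattice_coords (s, t)) \<partial>lborel \<partial>lborel)"
    unfolding lattice_coords_eq by simp
  also have "\<dots> = (\<integral>\<^sup>+w. F (lattice_coords w) \<partial>(lborel \<Otimes>\<^sub>M lborel))"
    by (rule lborel.nn_integral_fst) measurable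
  finally show ?thesis
    by (simp add: lborel_prod)
qed

text \<open>The change of variables restated as an identity of measures, the form in which it
  applies to Bochner integrals of complex functions.\<close>

lemma lborel_eq_density_lattice_coords:
  "(lborel :: (real \<times> real) measure) = density (distr lborel borel lattice_coords) (\<lambda>_. ennreal 2)"
proof (rule measure_eqI)
  fix A :: "(real \<times> real) set" assume "A \<in> sets lborel"
  then have [measurable]: "A \<in> sets borel" by simp
  have "emeasure lborel A = (\<integral>\<^sup>+z. indicator A z \<partial>lborel)" by simp
  also have "\<dots> = 2 * (\<integral>\<^sup>+w. indicator A (lattice_coords w) \<partial>lborel)"
    by (rule nn_integral_lborel_lattice_coords) measurable
  also have "\<dots> = emeasure (density (distr lborel borel lattice_coords) (\<lambda>_. ennreal 2)) A"
    by (subst emeasure_density)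
      (simp_all add: nn_integral_cmult nn_integral_distr del: nn_integral_indicator)
  finally show "emeasure lborel A = emeasure (density (distr lborel borel lattice_coords) (\<lambda>_. ennreal 2)) A" .
qed simp

text \<open>Half-open like the period cell, so that \<open>lattice_coords\<close> matches the two
  exactly and \<open>frac\<close> is the identity on both coordinates.\<close>

definition unit_square :: "(real \<times> real) measure" where
  "unit_square = restrict_space lborel ({0..<1} \<times> {0..<1})"

lemma borel_measurable_unit_squareI: "f \<in> borel_measurable borel \<Longrightarrow> f \<in> borel_measurable unit_square"
  unfolding unit_square_def by (intro measurable_restrict_space1) simp

lemma square_borel [measurable]: "{0..<1} \<times> {0..<1} \<in> sets (borel :: (real \<times> real) measure)"
  unfolding borel_prod[symmetric] by measurable

lemma space_unit_square: "space unit_square = {0..<1} \<times> {0..<1}"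
  by (simp add: unit_square_def space_restrict_space)

lemma period_cell_eq: "period_cell u_shift v_shift =
    {z. 0 \<le> u_coord z \<and> u_coord z < 1 \<and> 0 \<le> v_coord z \<and> v_coord z < 1}" (is "_ = ?C")
proof (intro set_eqI iffI)
  fix z assume "z \<in> period_cell u_shift v_shift"
  then obtain s t where "z = lattice_coords (s, t)" "0 \<le> s" "s < 1" "0 \<le> t" "t < 1"
    unfolding period_cell_def by auto
  then show "z \<in> ?C"
    by (simp only: mem_Collect_eq u_coord_lattice_coords v_coord_lattice_coords) simp
next
  fix z assume z: "z \<in> ?C"
  have "z = u_coord z *\<^sub>R u_shift + v_coord z *\<^sub>R v_shift"
    by (cases z) (simp add: u_coord_def v_coord_def u_shift_def v_shift_def field_simps)
  with z show "z \<in> period_cell u_shift v_shift"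
    unfolding period_cell_def by blast
qed

lemma period_cell_borel [measurable]: "period_cell u_shift v_shift \<in> sets borel"
  unfolding period_cell_eq by measurable

lemma lattice_coords_mem_period_cell_iff:
  "lattice_coords w \<in> period_cell u_shift v_shift \<longleftrightarrow> w \<in> {0..<1} \<times> {0..<1}"
  by (cases w) (simp only: period_cell_eq mem_Collect_eq u_coord_lattice_coords v_coord_lattice_coords, auto)

text \<open>For a Borel integrand the completion of the measure changes nothing, so the linear
  substitution on \<open>lborel\<close> applies.\<close>

lemma nn_integral_period_cell:
  assumes [measurable]: "F \<in> borel_measurable borel"
  shows "(\<integral>\<^sup>+z \<in> period_cell u_shift v_shift. F z \<partial>lebesgue) =
    2 * (\<integral>\<^sup>+w. F (lattice_coords w) \<partial>unit_square)"
proof -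
  have "(\<integral>\<^sup>+z \<in> period_cell u_shift v_shift. F z \<partial>lebesgue) =
      2 * (\<integral>\<^sup>+w. F (lattice_coords w) * indicator (period_cell u_shift v_shift) (lattice_coords w) \<partial>lborel)"
    unfolding nn_integral_completion by (rule nn_integral_lborel_lattice_coords) measurable
  also have "(\<integral>\<^sup>+w. F (lattice_coords w) * indicator (period_cell u_shift v_shift) (lattice_coords w) \<partial>lborel)
      = (\<integral>\<^sup>+w. F (lattice_coords w) * indicator ({0..<1} \<times> {0..<1}) w \<partial>lborel)"
    by (simp only: indicator_def lattice_coords_mem_period_cell_iff)
  also have "\<dots> = (\<integral>\<^sup>+w. F (lattice_coords w) \<partial>unit_square)"
    unfolding unit_square_def by (rule nn_integral_restrict_space[symmetric]) simp
  finally show ?thesis .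
qed

lemma set_integral_period_cell:
  fixes F :: "real \<times> real \<Rightarrow> complex"
  assumes [measurable]: "F \<in> borel_measurable borel"
  shows "(LINT z:period_cell u_shift v_shift|lebesgue. F z) =
    2 * (LINT w|unit_square. F (lattice_coords w))"
proof -
  let ?G = "\<lambda>z. indicator (period_cell u_shift v_shift) z *\<^sub>R F z"
  have "(LINT z:period_cell u_shift v_shift|lebesgue. F z) = (LINT z|lborel. ?G z)"
    unfolding set_lebesgue_integral_def by (rule integral_completion) measurable
  also have "\<dots> = (LINT z|density (distr lborel borel lattice_coords) (\<lambda>_. ennreal 2). ?G z)"
    by (subst lborel_eq_density_lattice_coords) (rule refl)
  also have "\<dots> = (LINT w|lborel. 2 *\<^sub>R ?G (lattice_coords w))"
    by (subst integral_density; (subst integral_distr)?; simp)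
  also have "\<dots> = (LINT w|lborel. 2 *\<^sub>R (indicator ({0..<1} \<times> {0..<1}) w *\<^sub>R F (lattice_coords w)))"
    by (simp only: indicator_def lattice_coords_mem_period_cell_iff)
  also have "\<dots> = 2 *\<^sub>R (LINT w|lborel. indicator ({0..<1} \<times> {0..<1}) w *\<^sub>R F (lattice_coords w))"
    by (rule integral_scaleR_right)
  also have "(LINT w|lborel. indicator ({0..<1} \<times> {0..<1}) w *\<^sub>R F (lattice_coords w)) =
      (LINT w|unit_square. F (lattice_coords w))"
    unfolding unit_square_def by (rule integral_restrict_space[symmetric]) simp
  finally show ?thesis
    by (simp add: scaleR_conv_of_real)
qed

lemma emeasure_unit_square: "emeasure unit_square (space unit_square) = 1"
proof -
  have "emeasure unit_square (space unit_square) = emeasure (lborel \<Otimes>\<^sub>M lborel) ({0..<1::real} \<times> {0..<1::real})"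
    unfolding space_unit_square unfolding unit_square_def
    by (subst emeasure_restrict_space) (auto simp: lborel_prod)
  also have "\<dots> = 1"
    by (subst lborel.emeasure_pair_measure_Times) auto
  finally show ?thesis .
qed

interpretation unit_square: finite_measure unit_square
  by (rule finite_measureI) (simp add: emeasure_unit_square)

lemma measure_period_cell: "measure lebesgue (period_cell u_shift v_shift) = 2"
proof -
  have "emeasure lebesgue (period_cell u_shift v_shift) =
      (\<integral>\<^sup>+z \<in> period_cell u_shift v_shift. 1 \<partial>lebesgue)"
    by simp
  also have "\<dots> = 2"
    by (subst nn_integral_period_cell) (simp_all add: emeasure_unit_square)
  finally show ?thesis by (simp add: measure_def)
qed

text \<open>Fubini, with integrability supplied by the bound on a space of finite measure. The
  closed intervals on the right differ from the half-open ones by null sets and suit the fundamental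
  theorem of calculus.\<close>

lemma integral_unit_square:
  fixes F :: "real \<times> real \<Rightarrow> complex"
  assumes [measurable]: "F \<in> borel_measurable borel" and bdd: "\<And>z. norm (F z) \<le> B"
  shows "(LINT w|unit_square. F w) = (LINT s:{0..1}|lborel. LINT t:{0..1}|lborel. F (s, t))"
proof -
  have half_open: "(LINT t|lborel. indicator {0..<1} t *\<^sub>R g t) = (LINT t|lborel. indicator {0..1} t *\<^sub>R g t)"
    if [measurable]: "g \<in> borel_measurable borel" for g :: "real \<Rightarrow> complex"
    by (rule integral_cong_AE, measurable)
      (use AE_lborel_singleton[of "1 :: real"] in \<open>auto elim!: eventually_mono simp: indicator_def\<close>)
  let ?G = "\<lambda>w. indicator ({0..<1} \<times> {0..<1}) w *\<^sub>R F w"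
  have [measurable]: "F \<in> borel_measurable (borel \<Otimes>\<^sub>M borel)"
    by (simp add: borel_prod)
  have meas: "(\<lambda>t. F (s, t)) \<in> borel_measurable borel" for s
    by measurable
  have meas': "(\<lambda>s. LINT t|lborel. indicator {0..1} t *\<^sub>R F (s, t)) \<in> borel_measurable borel"
    by measurable
  have "integrable unit_square F"
    by (rule unit_square.integrable_const_bound[of _ B])
      (auto simp: bdd intro: borel_measurable_unit_squareI)
  then have int: "integrable (lborel \<Otimes>\<^sub>M lborel) ?G"
    unfolding unit_square_def by (subst (asm) integrable_restrict_space) (auto simp: lborel_prod)
  have "(LINT w|unit_square. F w) = (LINT w|(lborel \<Otimes>\<^sub>M lborel). ?G w)"
    unfolding unit_square_def by (subst integral_restrict_space) (auto simp: lborel_prod)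
  also have "\<dots> = (LINT s|lborel. LINT t|lborel. ?G (s, t))"
    by (rule lborel_pair.integral_fst'[OF int, symmetric])
  also have "\<dots> = (LINT s|lborel. indicator {0..<1} s *\<^sub>R (LINT t|lborel. indicator {0..<1} t *\<^sub>R F (s, t)))"
    by (simp only: indicator_times scaleR_scaleR[symmetric] integral_scaleR_right fst_conv snd_conv)
  also have "\<dots> = (LINT s|lborel. indicator {0..1} s *\<^sub>R (LINT t|lborel. indicator {0..1} t *\<^sub>R F (s, t)))"
    by (simp only: half_open meas meas')
  finally show ?thesis
    by (simp add: set_lebesgue_integral_def)
qed

subsection \<open>Fourier coefficients of the triangle\<close>

text \<open>Bessel's identity. After expanding the square, each of the two cross terms and the
  double sum integrates to the sum of the squared coefficients; two are subtracted and one is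
  added.\<close>

lemma square_norm_diff_orthonormal_sum:
  fixes e :: "'i \<Rightarrow> 'a \<Rightarrow> complex"
  assumes "finite K"
    and int: "integrable M (\<lambda>x. f x * cnj (f x))" "\<And>k. k \<in> K \<Longrightarrow> integrable M (\<lambda>x. f x * cnj (e k x))"
      "\<And>j k. j \<in> K \<Longrightarrow> k \<in> K \<Longrightarrow> integrable M (\<lambda>x. e j x * cnj (e k x))"
    and orth: "\<And>j k. j \<in> K \<Longrightarrow> k \<in> K \<Longrightarrow> (LINT x|M. e j x * cnj (e k x)) = of_bool (j = k)"
    and c: "\<And>k. k \<in> K \<Longrightarrow> c k = (LINT x|M. f x * cnj (e k x))"
  shows "(LINT x|M. of_real ((cmod (f x - (\<Sum>k\<in>K. c k * e k x)))\<^sup>2)) =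
    (LINT x|M. f x * cnj (f x)) - of_real (\<Sum>k\<in>K. (cmod (c k))\<^sup>2)"
proof -
  let ?fe = "\<lambda>k x. f x * cnj (e k x)" and ?ee = "\<lambda>j k x. e j x * cnj (e k x)"
  have "(LINT x|M. of_real ((cmod (f x - (\<Sum>k\<in>K. c k * e k x)))\<^sup>2)) =
      (LINT x|M. f x * cnj (f x) - (\<Sum>k\<in>K. cnj (c k) * ?fe k x) - (\<Sum>k\<in>K. c k * cnj (?fe k x))
        + (\<Sum>j\<in>K. \<Sum>k\<in>K. c j * cnj (c k) * ?ee j k x))"
  proof (intro Bochner_Integration.integral_cong refl)
    fix x
    let ?S = "\<Sum>k\<in>K. c k * e k x"
    have "of_real ((cmod (f x - ?S))\<^sup>2) = (f x - ?S) * cnj (f x - ?S)"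
      by (rule complex_norm_square)
    also have "\<dots> = f x * cnj (f x) - f x * cnj ?S - ?S * cnj (f x) + ?S * cnj ?S"
      by (simp only: complex_cnj_diff) (simp add: algebra_simps)
    also have "f x * cnj ?S = (\<Sum>k\<in>K. cnj (c k) * ?fe k x)"
      by (simp add: sum_distrib_left mult_ac)
    also have "?S * cnj (f x) = (\<Sum>k\<in>K. c k * cnj (?fe k x))"
      by (simp add: sum_distrib_left sum_distrib_right mult_ac)
    also have "?S * cnj ?S = (\<Sum>j\<in>K. \<Sum>k\<in>K. c j * cnj (c k) * ?ee j k x)"
      by (simp add: sum_product mult_ac)
    finally show "of_real ((cmod (f x - ?S))\<^sup>2) = f x * cnj (f x) - (\<Sum>k\<in>K. cnj (c k) * ?fe k x)
        - (\<Sum>k\<in>K. c k * cnj (?fe k x)) + (\<Sum>j\<in>K. \<Sum>k\<in>K. c j * cnj (c k) * ?ee j k x)" .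
  qed
  also have "\<dots> = (LINT x|M. f x * cnj (f x)) - (LINT x|M. (\<Sum>k\<in>K. cnj (c k) * ?fe k x))
      - (LINT x|M. (\<Sum>k\<in>K. c k * cnj (?fe k x)))
      + (LINT x|M. (\<Sum>j\<in>K. \<Sum>k\<in>K. c j * cnj (c k) * ?ee j k x))"
    using int by (simp only: Bochner_Integration.integral_add Bochner_Integration.integral_diff
        Bochner_Integration.integrable_diff Bochner_Integration.integrable_sum
          integrable_mult_right integrable_cnj)
  also have "(LINT x|M. (\<Sum>k\<in>K. cnj (c k) * ?fe k x)) = (\<Sum>k\<in>K. cnj (c k) * (LINT x|M. ?fe k x))"
    using int by (subst Bochner_Integration.integral_sum) auto
  also have "(LINT x|M. (\<Sum>k\<in>K. c k * cnj (?fe k x))) = (\<Sum>k\<in>K. c k * (LINT x|M. cnj (?fe k x)))"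
    using int(2) by (subst Bochner_Integration.integral_sum)
      (auto simp del: complex_cnj_mult intro!: integrable_mult_right integrable_cnj)
  also have "(LINT x|M. (\<Sum>j\<in>K. \<Sum>k\<in>K. c j * cnj (c k) * ?ee j k x)) =
      (\<Sum>j\<in>K. \<Sum>k\<in>K. c j * cnj (c k) * (LINT x|M. ?ee j k x))"
    using int(3) by (simp add: Bochner_Integration.integral_sum Bochner_Integration.integrable_sum)
  also have "(\<Sum>k\<in>K. cnj (c k) * (LINT x|M. ?fe k x)) = of_real (\<Sum>k\<in>K. (cmod (c k))\<^sup>2)"
    by (simp add: c[symmetric] mult.commute flip: complex_norm_square)
  also have "(\<Sum>k\<in>K. c k * (LINT x|M. cnj (?fe k x))) = of_real (\<Sum>k\<in>K. (cmod (c k))\<^sup>2)"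
    by (simp only: Bochner_Integration.integral_cnj) (simp add: c[symmetric] flip: complex_norm_square)
  \<comment> \<open>Orthonormality leaves only the diagonal of the double sum.\<close>
  also have "(\<Sum>j\<in>K. \<Sum>k\<in>K. c j * cnj (c k) * (LINT x|M. ?ee j k x)) = (\<Sum>j\<in>K. c j * cnj (c j))"
    using \<open>finite K\<close> by (intro sum.cong refl) (simp add: orth of_bool_def if_distrib sum.delta cong: if_cong)
  also have "\<dots> = of_real (\<Sum>k\<in>K. (cmod (c k))\<^sup>2)"
    by (simp flip: complex_norm_square)
  finally show ?thesis by simp
qed

section \<open>One-dimensional integrals of exponentials\<close>

lemma has_vector_derivative_cis_mult:
  "((\<lambda>t. cis (c * t)) has_vector_derivative \<i> * of_real c * cis (c * t)) (at t within A)"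
proof -
  have "((\<lambda>z. exp (\<i> * (of_real c * z))) has_field_derivative \<i> * of_real c * exp (\<i> * (of_real c * of_real t)))
      (at (of_real t))"
    by (auto intro!: derivative_eq_intros)
  from has_vector_derivative_real_field[OF this] show ?thesis
    by (simp add: cis_conv_exp)
qed

lemma continuous_on_cis_mult [continuous_intros]: "continuous_on A (\<lambda>t. cis (c * t))"
  unfolding cis_conv_exp by (intro continuous_intros)

lemma set_integral_cis:
  assumes "c \<noteq> 0" "a \<le> b"
  shows "(LINT t:{a..b}|lborel. cis (c * t)) = (cis (c * b) - cis (c * a)) / (\<i> * of_real c)"
proof -
  have "(LINT t:{a..b}|lborel. cis (c * t)) = cis (c * b) / (\<i> * of_real c) - cis (c * a) / (\<i> * of_real c)"
    unfolding set_lebesgue_integral_def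
  proof (rule integral_FTC_atLeastAtMost)
    fix t :: real
    show "((\<lambda>t. cis (c * t) / (\<i> * of_real c)) has_vector_derivative cis (c * t)) (at t within {a..b})"
      using has_vector_derivative_divide[OF has_vector_derivative_cis_mult[of c t "{a..b}"], of "\<i> * of_real c"]
        assms by simp
  qed (use assms in \<open>auto intro!: continuous_intros\<close>)
  then show ?thesis by (simp add: diff_divide_distrib)
qed

lemma cis_2pi_int [simp]: "cis (2 * pi * of_int n) = 1"
  by (rule cis_multiple_2pi) simp

lemma set_integral_cis_period: "(LINT t:{0..1}|lborel. cis (2 * pi * of_int n * t)) = of_bool (n = 0)"
proof (cases "n = 0")
  case True
  then show ?thesis by (simp add: set_integral_const)
next
  case False
  then show ?thesis by (subst set_integral_cis) auto
qed

lemma set_integral_mult_cis_period: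
  assumes "n \<noteq> 0"
  shows "(LINT t:{0..1}|lborel. of_real t * cis (2 * pi * of_int n * t)) = 1 / (2 * pi * \<i> * of_int n)"
proof -
  let ?c = "2 * pi * of_int n"
  \<comment> \<open>The primitive produced by integration by parts. Since \<open>cis ?c = 1\<close>,
    the terms \<open>1 / ?c^2\<close> at the two ends cancel.\<close>
  let ?F = "\<lambda>t. (of_real t / (\<i> * of_real ?c) + 1 / (of_real ?c)\<^sup>2) * cis (?c * t)"
  have "(LINT t:{0..1}|lborel. of_real t * cis (?c * t)) = ?F 1 - ?F 0"
    unfolding set_lebesgue_integral_def
  proof (rule integral_FTC_atLeastAtMost)
    fix t :: real
    have "((\<lambda>t. of_real t / (\<i> * of_real ?c) + 1 / (of_real ?c)\<^sup>2) has_vector_derivative 1 / (\<i> * of_real ?c))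
        (at t within {0..1})"
      by (auto intro!: derivative_eq_intros)
    from has_vector_derivative_mult[OF this has_vector_derivative_cis_mult[of ?c t "{0..1}"]]
    show "(?F has_vector_derivative of_real t * cis (?c * t)) (at t within {0..1})"
      by (rule has_vector_derivative_eq_rhs) (use assms in \<open>simp add: field_simps power2_eq_square\<close>)
  qed (auto intro!: continuous_intros)
  also have "?F 1 - ?F 0 = 1 / (\<i> * of_real ?c)"
    by simp
  finally show ?thesis by (simp add: mult_ac)
qed

section \<open>Characters on the unit square and their orthonormality\<close>

definition lattice_character :: "int \<times> int \<Rightarrow> real \<times> real \<Rightarrow> complex" where
  "lattice_character k w = cis (2 * pi * (of_int (fst k) * fst w + of_int (snd k) * snd w))"

lemma borel_measurable_cis [measurable]: "cis \<in> borel_measurable borel"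
  unfolding cis_conv_exp[abs_def] by (intro borel_measurable_continuous_onI continuous_intros)

lemma borel_measurable_cnj [measurable]: "cnj \<in> borel_measurable borel"
  by (intro borel_measurable_continuous_onI continuous_intros)

lemma borel_measurable_lattice_character [measurable]: "lattice_character k \<in> borel_measurable borel"
  unfolding lattice_character_def[abs_def] borel_prod[symmetric] by measurable

lemma norm_lattice_character [simp]: "cmod (lattice_character k w) = 1"
  by (simp add: lattice_character_def)

lemma lattice_character_pair:
  "lattice_character (m, n) (s, t) = cis (2 * pi * of_int m * s) * cis (2 * pi * of_int n * t)"
  by (simp add: lattice_character_def cis_mult algebra_simps)

lemma cnj_lattice_character: "cnj (lattice_character k w) = lattice_character (- k) w"
  by (simp add: lattice_character_def cis_cnj algebra_simps)

lemma lattice_character_mult_cnj: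
  "lattice_character j w * cnj (lattice_character k w) = lattice_character (j - k) w"
  by (simp add: lattice_character_def cis_cnj cis_mult algebra_simps)

lemma integral_lattice_character: "(LINT w|unit_square. lattice_character k w) = of_bool (k = 0)"
proof (cases k)
  case (Pair m n)
  have "(LINT w|unit_square. lattice_character k w) =
      (LINT s:{0..1}|lborel. LINT t:{0..1}|lborel. lattice_character k (s, t))"
    by (rule integral_unit_square[where B = 1]) simp_all
  also have "\<dots> = of_bool (m = 0) * of_bool (n = 0)"
    by (simp add: Pair lattice_character_pair set_integral_cis_period)
  finally show ?thesis
    by (simp add: Pair zero_prod_def)
qed

text \<open>The first two branches are the nonconstant Fourier coefficients of \<open>{u}\<close>
  and \<open>{v}\<close>, the diagonal branch those of \<open>-{u + v}\<close>. The value at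
  \<open>(0, 0)\<close> is 0 because the mean is subtracted.\<close>

definition triangle_coeff :: "int \<times> int \<Rightarrow> complex" where
  "triangle_coeff k = (case k of (m, n) \<Rightarrow>
     if m \<noteq> 0 \<and> n = 0 then \<i> / (2 * pi * of_int m)
     else if m = 0 \<and> n \<noteq> 0 then \<i> / (2 * pi * of_int n)
     else if m \<noteq> 0 \<and> m = n then - \<i> / (2 * pi * of_int n) else 0)"

text \<open>On the unit square this is the indicator of \<open>S_set\<close> minus
  \<open>1/2\<close>, written in the coordinates \<open>(u, v)\<close>.\<close>

definition triangle_sign :: "real \<times> real \<Rightarrow> complex" where
  "triangle_sign w = of_bool (fst w + snd w > 1) - 1 / 2"

lemma borel_measurable_triangle [measurable]:
  "(\<lambda>w. of_bool (fst w + snd w > 1)) \<in> borel_measurable (borel :: (real \<times> real) measure)"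
  unfolding borel_prod[symmetric] by measurable

lemma borel_measurable_triangle_sign [measurable]: "triangle_sign \<in> borel_measurable borel"
  unfolding triangle_sign_def[abs_def] by measurable

lemma norm_triangle_sign [simp]: "cmod (triangle_sign w) = 1 / 2"
  by (simp add: triangle_sign_def of_bool_def)

text \<open>Up to the single point \<open>t = 1 - s\<close>, the condition cuts out the interval
  \<open>[1 - s, 1]\<close>, on which the exponential is integrated explicitly.\<close>

lemma set_integral_cis_upper:
  assumes "0 \<le> s" "s \<le> 1"
  shows "(LINT t:{0..1}|lborel. of_bool (s + t > 1) * cis (2 * pi * of_int n * t)) =
    (if n = 0 then of_real s
     else (1 - cis (2 * pi * of_int (- n) * s)) / (2 * pi * \<i> * of_int n))"
proof -
  have "(LINT t:{0..1}|lborel. of_bool (s + t > 1) * cis (2 * pi * of_int n * t)) =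
      (LINT t:{1 - s..1}|lborel. cis (2 * pi * of_int n * t))"
    unfolding set_lebesgue_integral_def
    by (rule integral_cong_AE, measurable)
      (use AE_lborel_singleton[of "1 - s"] assms in \<open>auto elim!: eventually_mono simp: indicator_def\<close>)
  also have "\<dots> = (if n = 0 then of_real s
      else (1 - cis (2 * pi * of_int (- n) * s)) / (2 * pi * \<i> * of_int n))"
  proof (cases "n = 0")
    case True
    then show ?thesis using assms by (simp add: set_integral_const scaleR_conv_of_real)
  next
    case False
    \<comment> \<open>By periodicity the lower endpoint contributes an exponential in
      \<open>- s\<close>.\<close>
    have "cis (2 * pi * of_int n * (1 - s)) = cis (2 * pi * of_int n) * cis (2 * pi * of_int (- n) * s)"
      unfolding cis_mult by (rule arg_cong[where f = cis]) (simp add: algebra_simps)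
    moreover have "(LINT t:{1 - s..1}|lborel. cis (2 * pi * of_int n * t)) =
        (cis (2 * pi * of_int n * 1) - cis (2 * pi * of_int n * (1 - s))) / (\<i> * of_real (2 * pi * of_int n))"
      by (rule set_integral_cis) (use False assms in auto)
    ultimately have "(LINT t:{1 - s..1}|lborel. cis (2 * pi * of_int n * t)) =
        (1 - cis (2 * pi * of_int (- n) * s)) / (\<i> * of_real (2 * pi * of_int n))"
      by (simp only: mult_1_right cis_2pi_int mult_1_left)
    also have "\<i> * of_real (2 * pi * of_int n) = 2 * pi * \<i> * of_int n"
      by simp
    finally show ?thesis
      by (simp only: False if_False)
  qed
  finally show ?thesis .
qed

lemma set_integrable_cis: "set_integrable lborel {a..b} (\<lambda>t. cis (c * t))"
  by (intro borel_integrable_atLeastAtMost' continuous_intros)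

text \<open>Integrate in \<open>t\<close> first. If \<open>n = 0\<close>, this leaves the first
  moment of an exponential in \<open>s\<close>; otherwise it leaves the difference of the
  exponentials with indices \<open>m\<close> and \<open>m - n\<close>, whose integrals survive only
  for \<open>m = 0\<close> and \<open>m = n\<close>.\<close>

lemma integral_triangle_mult_lattice_character:
  "(LINT w|unit_square. of_bool (fst w + snd w > 1) * lattice_character (m, n) w) =
    (if n = 0 then (if m = 0 then 1 / 2 else 1 / (2 * pi * \<i> * of_int m))
     else (of_bool (m = 0) - of_bool (m = n)) / (2 * pi * \<i> * of_int n))"
proof -
  have "(LINT w|unit_square. of_bool (fst w + snd w > 1) * lattice_character (m, n) w) =
      (LINT s:{0..1}|lborel. LINT t:{0..1}|lborel.
        of_bool (fst (s, t) + snd (s, t) > 1) * lattice_character (m, n) (s, t))"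
    by (rule integral_unit_square[where B = 1]) (simp_all add: norm_mult)
  also have "\<dots> = (LINT s:{0..1}|lborel. cis (2 * pi * of_int m * s) *
      (LINT t:{0..1}|lborel. of_bool (s + t > 1) * cis (2 * pi * of_int n * t)))"
    by (simp only: lattice_character_pair fst_conv snd_conv mult.left_commute[of "of_bool _"] set_integral_mult_right)
  also have "\<dots> = (LINT s:{0..1}|lborel. cis (2 * pi * of_int m * s) *
     (if n = 0 then of_real s else (1 - cis (2 * pi * of_int (- n) * s)) / (2 * pi * \<i> * of_int n)))"
    by (rule set_lebesgue_integral_cong) (simp_all add: set_integral_cis_upper)
  also have "\<dots> = (if n = 0 then (if m = 0 then 1 / 2 else 1 / (2 * pi * \<i> * of_int m))
     else (of_bool (m = 0) - of_bool (m = n)) / (2 * pi * \<i> * of_int n))"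
  proof (cases "n = 0")
    case True
    show ?thesis
    proof (cases "m = 0")
      case True
      have "(LINT s:{0..1}|lborel. complex_of_real s) = of_real (LINT s:{0..1}|lborel. s)"
        by (rule set_integral_complex_of_real)
      also have "(LINT s:{0..1}|lborel. s :: real) = 1 / 2"
        using integral_power[of 0 1 1] by (simp add: set_lebesgue_integral_def mult.commute)
      finally show ?thesis using \<open>n = 0\<close> \<open>m = 0\<close> by simp
    next
      case False
      then show ?thesis using \<open>n = 0\<close> set_integral_mult_cis_period[of m] by (simp add: mult_ac)
    qed
  next
    case False
    have "(LINT s:{0..1}|lborel. cis (2 * pi * of_int m * s) *
          ((1 - cis (2 * pi * of_int (- n) * s)) / (2 * pi * \<i> * of_int n))) =
        (LINT s:{0..1}|lborel. (cis (2 * pi * of_int m * s) - cis (2 * pi * of_int (m - n) * s))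
          / (2 * pi * \<i> * of_int n))"
    proof (intro set_lebesgue_integral_cong ballI allI impI)
      fix s :: real
      have "cis (2 * pi * of_int m * s) * cis (2 * pi * of_int (- n) * s) = cis (2 * pi * of_int (m - n) * s)"
        unfolding cis_mult by (simp add: algebra_simps)
      then show "cis (2 * pi * of_int m * s) * ((1 - cis (2 * pi * of_int (- n) * s)) / (2 * pi * \<i> * of_int n))
          = (cis (2 * pi * of_int m * s) - cis (2 * pi * of_int (m - n) * s)) / (2 * pi * \<i> * of_int n)"
        by (simp only: times_divide_eq_right right_diff_distrib mult_1_right)
    qed simp
    also have "\<dots> = ((LINT s:{0..1}|lborel. cis (2 * pi * of_int m * s))
        - (LINT s:{0..1}|lborel. cis (2 * pi * of_int (m - n) * s))) / (2 * pi * \<i> * of_int n)"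
      by (simp only: set_integral_divide_zero set_integral_diff(2)[OF set_integrable_cis set_integrable_cis])
    also have "\<dots> = (of_bool (m = 0) - of_bool (m = n)) / (2 * pi * \<i> * of_int n)"
      by (simp only: set_integral_cis_period) simp
    finally show ?thesis using False by simp
  qed
  finally show ?thesis .
qed

lemma integrable_unit_square_bounded:
  fixes f :: "real \<times> real \<Rightarrow> complex"
  assumes "f \<in> borel_measurable borel" "\<And>w. cmod (f w) \<le> B"
  shows "integrable unit_square f"
  by (rule unit_square.integrable_const_bound[of _ B])
    (use assms in \<open>auto intro: borel_measurable_unit_squareI\<close>)

text \<open>Conjugation replaces \<open>k\<close> by \<open>- k\<close>, which accounts for the
  signs in \<open>triangle_coeff\<close>. Subtracting \<open>1/2\<close> affects only the
  coefficient at \<open>k = 0\<close>.\<close>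

lemma integral_triangle_sign_mult_cnj:
  "(LINT w|unit_square. triangle_sign w * cnj (lattice_character k w)) = triangle_coeff k"
proof (cases k)
  case (Pair m n)
  have "(LINT w|unit_square. triangle_sign w * cnj (lattice_character k w)) =
     (LINT w|unit_square. of_bool (fst w + snd w > 1) * lattice_character (- k) w - 1 / 2 * lattice_character (- k) w)"
    by (simp add: triangle_sign_def cnj_lattice_character algebra_simps)
  also have "\<dots> = (LINT w|unit_square. of_bool (fst w + snd w > 1) * lattice_character (- k) w)
      - (LINT w|unit_square. 1 / 2 * lattice_character (- k) w)"
    by (intro Bochner_Integration.integral_diff integrable_unit_square_bounded[where B = 1])
      (simp_all add: norm_mult)
  also have "\<dots> = triangle_coeff k"
    unfolding integral_mult_right_zero integral_lattice_character Pair uminus_Pair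
      integral_triangle_mult_lattice_character
    by (auto simp: triangle_coeff_def zero_prod_def field_simps)
  finally show ?thesis .
qed

text \<open>Bessel's identity for the orthonormal characters. The scalar \<open>a\<close> allows one
  computation to serve both functions in the claim about the transform.\<close>

lemma L2_dist_triangle_sign_partial_sum:
  assumes "finite K"
  shows "(\<integral>\<^sup>+w. ennreal ((cmod (a * triangle_sign w - (\<Sum>k\<in>K. a * triangle_coeff k * lattice_character k w)))\<^sup>2)
      \<partial>unit_square) = ennreal ((cmod a)\<^sup>2 * (1 / 4 - (\<Sum>k\<in>K. (cmod (triangle_coeff k))\<^sup>2)))"
proof -
  let ?d = "\<lambda>w. triangle_sign w - (\<Sum>k\<in>K. triangle_coeff k * lattice_character k w)"
  \<comment> \<open>A crude pointwise bound from the triangle inequality, used only for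
    integrability.\<close>
  let ?B = "1 / 2 + (\<Sum>k\<in>K. cmod (triangle_coeff k))"
  have "cmod (?d w) \<le> ?B" for w
    by (rule order_trans[OF norm_triangle_ineq4 add_mono])
      (auto intro!: order_trans[OF norm_sum] sum_mono simp: norm_mult)
  then have "(cmod (?d w))\<^sup>2 \<le> ?B\<^sup>2" for w
    by (intro power_mono) auto
  then have int: "integrable unit_square (\<lambda>w. (cmod (?d w))\<^sup>2)"
    by (intro unit_square.integrable_const_bound[of _ "?B\<^sup>2"] borel_measurable_unit_squareI) auto
  have "of_real (LINT w|unit_square. (cmod (?d w))\<^sup>2) = (LINT w|unit_square. complex_of_real ((cmod (?d w))\<^sup>2))"
    by (rule integral_complex_of_real[symmetric])
  also have "\<dots> = (LINT w|unit_square. triangle_sign w * cnj (triangle_sign w))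
      - of_real (\<Sum>k\<in>K. (cmod (triangle_coeff k))\<^sup>2)"
    using assms
    by (intro square_norm_diff_orthonormal_sum integrable_unit_square_bounded[where B = 1])
      (simp_all add: norm_mult lattice_character_mult_cnj integral_lattice_character integral_triangle_sign_mult_cnj)
  \<comment> \<open>The modulus is constantly \<open>1/2\<close> and the square has total mass
    1.\<close>
  also have "(LINT w|unit_square. triangle_sign w * cnj (triangle_sign w)) = 1 / 4"
    by (simp add: emeasure_unit_square measure_def power2_eq_square flip: complex_norm_square)
  finally have "of_real (LINT w|unit_square. (cmod (?d w))\<^sup>2) =
      complex_of_real (1 / 4 - (\<Sum>k\<in>K. (cmod (triangle_coeff k))\<^sup>2))"
    by simp
  then have eq: "(LINT w|unit_square. (cmod (?d w))\<^sup>2) = 1 / 4 - (\<Sum>k\<in>K. (cmod (triangle_coeff k))\<^sup>2)"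
    by (simp only: of_real_eq_iff)
  have "a * triangle_sign w - (\<Sum>k\<in>K. a * triangle_coeff k * lattice_character k w) = a * ?d w" for w
    by (simp add: right_diff_distrib sum_distrib_left mult.assoc)
  then have "(\<integral>\<^sup>+w. ennreal ((cmod (a * triangle_sign w
        - (\<Sum>k\<in>K. a * triangle_coeff k * lattice_character k w)))\<^sup>2) \<partial>unit_square) =
      (\<integral>\<^sup>+w. ennreal ((cmod a)\<^sup>2 * (cmod (?d w))\<^sup>2) \<partial>unit_square)"
    by (simp only: norm_mult power_mult_distrib)
  also have "\<dots> = ennreal (LINT w|unit_square. (cmod a)\<^sup>2 * (cmod (?d w))\<^sup>2)"
    by (intro nn_integral_eq_integral integrable_mult_right int) simp
  also have "\<dots> = ennreal ((cmod a)\<^sup>2 * (1 / 4 - (\<Sum>k\<in>K. (cmod (triangle_coeff k))\<^sup>2)))"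
    by (simp only: integral_mult_right_zero eq)
  finally show ?thesis .
qed

section \<open>The Parseval sum of the squared coefficients\<close>

lemma has_sum_int_inverse_squares: "((\<lambda>n::int. 1 / (of_int n)\<^sup>2) has_sum (pi\<^sup>2 / 3 :: real)) UNIV"
proof -
  \<comment> \<open>The Basel series; its terms are nonnegative, so the ordinary sum is also an
    unconditional one.\<close>
  have nat: "((\<lambda>n::nat. 1 / (real n + 1)\<^sup>2) has_sum (pi\<^sup>2 / 6)) UNIV"
    using inverse_squares_sums by (intro sums_nonneg_imp_has_sum) (auto simp: add.commute)
  have pos: "((\<lambda>n::int. 1 / (of_int n)\<^sup>2 :: real) has_sum (pi\<^sup>2 / 6)) (range (\<lambda>n. int n + 1))"
    by (subst has_sum_reindex) (use nat in \<open>auto simp: inj_on_def o_def\<close>)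
  have neg: "((\<lambda>n::int. 1 / (of_int n)\<^sup>2 :: real) has_sum (pi\<^sup>2 / 6)) (range (\<lambda>n. - (int n + 1)))"
  proof (subst has_sum_reindex)
    have "real_of_int (- (int n + 1)) = - (real n + 1)" for n by simp
    then show "((\<lambda>n::int. 1 / (of_int n)\<^sup>2 :: real) \<circ> (\<lambda>n. - (int n + 1)) has_sum pi\<^sup>2 / 6) UNIV"
      using nat by (simp only: o_def power2_minus)
  qed (auto simp: inj_on_def)
  have "((\<lambda>n::int. 1 / (of_int n)\<^sup>2 :: real) has_sum (pi\<^sup>2 / 6 + pi\<^sup>2 / 6))
      (range (\<lambda>n. int n + 1) \<union> range (\<lambda>n. - (int n + 1)))"
    by (rule has_sum_Un_disjoint[OF pos neg]) auto
  moreover have "n \<in> range (\<lambda>n. int n + 1) \<union> range (\<lambda>n. - (int n + 1))" if "n \<noteq> 0" for n :: int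
    using that by (cases n rule: int_cases3) (auto simp: image_iff intro: exI[of _ "nat _ - 1"] dest: gr0_implies_Suc)
  \<comment> \<open>Only \<open>n = 0\<close> is left uncovered, and there the term is 0 because
    division by zero yields 0.\<close>
  ultimately show ?thesis
    by (subst has_sum_cong_neutral[where S = "range (\<lambda>n. int n + 1) \<union> range (\<lambda>n. - (int n + 1))"
          and g = "\<lambda>n::int. 1 / (of_int n)\<^sup>2 :: real", symmetric]) auto
qed

text \<open>The support consists of three disjoint punctured copies of the integers, each
  contributing \<open>1/12\<close>. The total is the squared norm of \<open>triangle_sign\<close>,
  so Bessel's identity leaves no remainder in the limit.\<close>

lemma has_sum_triangle_coeff_squares:
  "((\<lambda>k. (cmod (triangle_coeff k))\<^sup>2) has_sum (1 / 4)) UNIV"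
proof -
  let ?g = "\<lambda>k. (cmod (triangle_coeff k))\<^sup>2"
  have half: "(?g has_sum (1 / 12)) (f ` (- {0}))"
    if "inj f" "\<And>n. n \<noteq> 0 \<Longrightarrow> cmod (triangle_coeff (f n)) = 1 / (2 * pi * \<bar>of_int n\<bar>)" for f :: "int \<Rightarrow> int \<times> int"
  proof (subst has_sum_reindex)
    \<comment> \<open>The sum may run over all integers, since the term at 0 is 0 by the same
      division convention.\<close>
    have "((\<lambda>n::int. 1 / (4 * pi\<^sup>2) * (1 / (of_int n)\<^sup>2)) has_sum (1 / (4 * pi\<^sup>2) * (pi\<^sup>2 / 3) :: real)) UNIV"
      by (rule has_sum_cmult_right has_sum_int_inverse_squares)+
    then have "((\<lambda>n::int. 1 / (4 * pi\<^sup>2) * (1 / (of_int n)\<^sup>2)) has_sum (1 / 12 :: real)) UNIV"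
      by simp
    then show "(?g \<circ> f has_sum 1 / 12) (- {0})"
      by (subst has_sum_cong_neutral[where T = UNIV and g = "\<lambda>n::int. 1 / (4 * pi\<^sup>2) * (1 / (of_int n)\<^sup>2)"])
        (auto simp: that(2) power_divide power_mult_distrib)
  qed (use that in \<open>auto intro: inj_on_subset\<close>)
  have A: "(?g has_sum (1 / 12)) ((\<lambda>m. (m, 0)) ` (- {0}))"
    by (rule half) (auto simp: inj_on_def triangle_coeff_def norm_divide norm_mult)
  have B: "(?g has_sum (1 / 12)) ((\<lambda>n. (0, n)) ` (- {0}))"
    by (rule half) (auto simp: inj_on_def triangle_coeff_def norm_divide norm_mult)
  have C: "(?g has_sum (1 / 12)) ((\<lambda>n. (n, n)) ` (- {0}))"
    by (rule half) (auto simp: inj_on_def triangle_coeff_def norm_divide norm_mult)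
  let ?U = "(\<lambda>m. (m, 0)) ` (- {0}) \<union> (\<lambda>n. (0, n)) ` (- {0}) \<union> (\<lambda>n. (n, n)) ` (- {0}) :: (int \<times> int) set"
  have "(?g has_sum (1 / 12 + 1 / 12 + 1 / 12)) ?U"
    by (intro has_sum_Un_disjoint A B C) auto
  moreover have "?g k = 0" if "k \<notin> ?U" for k
    using that by (cases k) (auto simp: triangle_coeff_def)
  ultimately show ?thesis
    by (subst has_sum_cong_neutral[where T = ?U and g = ?g]) auto
qed

subsection \<open>The double Hilbert transform\<close>

text \<open>For \<open>k = (m, n)\<close> this is \<open>2 * pi\<close> times the gradient of
  \<open>m * u + n * v\<close>, an element of the dual lattice.\<close>

definition lattice_frequency :: "int \<times> int \<Rightarrow> real \<times> real" where
  "lattice_frequency k = (- 2 * pi * (of_int (fst k) + of_int (snd k) / 2),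
     2 * pi * (of_int (fst k) + of_int (snd k)))"

lemma inner_lattice_frequency:
  "lattice_frequency k \<bullet> z = 2 * pi * (of_int (fst k) * u_coord z + of_int (snd k) * v_coord z)"
  by (cases z) (simp add: lattice_frequency_def u_coord_def v_coord_def field_simps)

lemma inj_lattice_frequency: "inj lattice_frequency"
proof (rule injI)
  fix j k assume "lattice_frequency j = lattice_frequency k"
  then have "lattice_frequency j \<bullet> z = lattice_frequency k \<bullet> z" for z by simp
  from this[of u_shift] this[of v_shift] show "j = k"
    by (simp add: inner_lattice_frequency u_coord_def v_coord_def u_shift_def v_shift_def prod_eq_iff)
qed

lemma u_coord_lattice: "u_coord (of_int m *\<^sub>R u_shift + of_int n *\<^sub>R v_shift) = of_int m"
  and v_coord_lattice: "v_coord (of_int m *\<^sub>R u_shift + of_int n *\<^sub>R v_shift) = of_int n"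
  using u_coord_lattice_coords[of "(of_int m, of_int n)"] v_coord_lattice_coords[of "(of_int m, of_int n)"]
  by simp_all

text \<open>A frequency is determined by its pairings with the two basis vectors, which are
  \<open>2 * pi\<close> times integers; these integers form the index. Conversely, integer
  combinations of integer coordinates are integers.\<close>

lemma frequencies_eq: "frequencies u_shift v_shift = range lattice_frequency"
proof (intro set_eqI iffI)
  fix \<omega> assume \<omega>: "\<omega> \<in> frequencies u_shift v_shift"
  have "u_shift \<in> plane_lattice u_shift v_shift"
    unfolding plane_lattice_def by (rule CollectI) (rule exI[of _ 1], rule exI[of _ 0], simp)
  moreover have "v_shift \<in> plane_lattice u_shift v_shift"
    unfolding plane_lattice_def by (rule CollectI) (rule exI[of _ 0], rule exI[of _ 1], simp)
  ultimately obtain m n :: int where "\<omega> \<bullet> u_shift = 2 * pi * of_int m" "\<omega> \<bullet> v_shift = 2 * pi * of_int n"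
    using \<omega> unfolding frequencies_def by blast
  then have "\<omega> = lattice_frequency (m, n)"
    by (cases \<omega>) (simp add: u_shift_def v_shift_def lattice_frequency_def field_simps)
  then show "\<omega> \<in> range lattice_frequency" by blast
next
  fix \<omega> assume "\<omega> \<in> range lattice_frequency"
  then obtain k where k: "\<omega> = lattice_frequency k" by blast
  show "\<omega> \<in> frequencies u_shift v_shift"
    unfolding frequencies_def
  proof (intro CollectI ballI)
    fix w assume "w \<in> plane_lattice u_shift v_shift"
    then obtain m n :: int where w: "w = of_int m *\<^sub>R u_shift + of_int n *\<^sub>R v_shift"
      unfolding plane_lattice_def by blast
    have "\<omega> \<bullet> w = 2 * pi * of_int (fst k * m + snd k * n)"
      unfolding k w inner_lattice_frequency u_coord_lattice v_coord_lattice by simp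
    then show "\<exists>l::int. \<omega> \<bullet> w = 2 * pi * of_int l" ..
  qed
qed

text \<open>Pulling the plane exponentials back to the unit square gives exactly the characters, so
  all computations made there transfer.\<close>

lemma exp_lattice_frequency:
  "exp (\<i> * of_real (lattice_frequency k \<bullet> lattice_coords w)) = lattice_character k w"
  "exp (- \<i> * of_real (lattice_frequency k \<bullet> lattice_coords w)) = cnj (lattice_character k w)"
  unfolding inner_lattice_frequency u_coord_lattice_coords v_coord_lattice_coords
  by (simp_all add: lattice_character_def exp_cnj cis_conv_exp)

text \<open>For \<open>k = (m, n)\<close> the symbol is
  \<open>sgn (2 * m + n) * sgn (m + n)\<close>. It equals 1 at \<open>(m, 0)\<close>,
  \<open>(0, n)\<close> and \<open>(n, n)\<close> for nonzero indices; elsewhere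
  \<open>triangle_coeff\<close> vanishes. At the origin the symbol is 0 and removes the constant
  \<open>b\<close>.\<close>

lemma symbol_mult_triangle_coeff:
  "of_real (double_hilbert_symbol (lattice_frequency k)) * (a * triangle_coeff k + b * of_bool (k = 0))
     = a * triangle_coeff k"
proof (cases k)
  case (Pair m n)
  have sgn_eq: "sgn (- 2 * pi * (x + y / 2)) = - sgn (2 * x + y)" "sgn (2 * pi * (x + y)) = sgn (x + y)"
    for x y :: real
  proof -
    have "- 2 * pi * (x + y / 2) = - (pi * (2 * x + y))" by (simp add: algebra_simps)
    then show "sgn (- 2 * pi * (x + y / 2)) = - sgn (2 * x + y)" by (simp only: sgn_minus sgn_mult) simp
  qed (simp add: sgn_mult)
  have "double_hilbert_symbol (lattice_frequency k) = sgn (2 * of_int m + of_int n) * sgn (of_int m + of_int n)"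
    unfolding double_hilbert_symbol_def lattice_frequency_def Pair fst_conv snd_conv sgn_eq by simp
  then show ?thesis
    by (auto simp: Pair triangle_coeff_def zero_prod_def sgn_if)
qed

section \<open>Transfer to \<open>S_set\<close> and convergence of the multiplied series\<close>

lemma indicator_S_set_lattice_coords:
  assumes "w \<in> space unit_square"
  shows "indicator S_set (lattice_coords w) = (of_bool (fst w + snd w > 1) :: complex)"
proof -
  have "frac (fst w) = fst w" "frac (snd w) = snd w"
    using assms by (auto simp: space_unit_square frac_eq)
  then show ?thesis
    unfolding indicator_def S_set_def mem_Collect_eq u_coord_lattice_coords v_coord_lattice_coords by simp
qed

lemma S_set_borel [measurable]: "S_set \<in> sets borel"
  unfolding S_set_def by measurable

lemma indicator_S_set_periodic:
  assumes "w \<in> plane_lattice u_shift v_shift"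
  shows "indicator S_set (z + w) = indicator S_set z"
proof -
  obtain m n :: int where w: "w = of_int m *\<^sub>R u_shift + of_int n *\<^sub>R v_shift"
    using assms unfolding plane_lattice_def by blast
  have "u_coord (z + w) = u_coord z + u_coord w" "v_coord (z + w) = v_coord z + v_coord w"
    by (cases z; cases w; simp add: u_coord_def v_coord_def field_simps)+
  then have "frac (u_coord (z + w)) = frac (u_coord z)" "frac (v_coord (z + w)) = frac (v_coord z)"
    unfolding w u_coord_lattice v_coord_lattice by simp_all
  then show ?thesis
    unfolding indicator_def S_set_def by simp
qed

lemma lattice_basis_uv_shift: "lattice_basis u_shift v_shift"
proof -
  have "u_shift \<notin> span {v_shift}"
    by (auto simp: span_singleton u_shift_def v_shift_def)
  moreover have "v_shift \<noteq> 0" "u_shift \<noteq> v_shift"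
    by (simp_all add: u_shift_def v_shift_def zero_prod_def)
  ultimately show ?thesis
    by (simp add: lattice_basis_def independent_insert)
qed

text \<open>The Jacobian 2 cancels against the area of the cell. The constant \<open>b\<close> is
  the mean of the function and appears only at \<open>k = 0\<close>.\<close>

lemma fourier_coeff_S_set:
  "fourier_coeff u_shift v_shift (\<lambda>z. a * (indicator S_set z - 1 / 2) + b) (lattice_frequency k) =
    a * triangle_coeff k + b * of_bool (k = 0)"
proof -
  let ?F = "\<lambda>z. (a * (indicator S_set z - 1 / 2) + b) * exp (- \<i> * of_real (lattice_frequency k \<bullet> z))"
  have "(LINT z:period_cell u_shift v_shift|lebesgue. ?F z) = 2 * (LINT w|unit_square. ?F (lattice_coords w))"
    by (rule set_integral_period_cell) measurable
  also have "(LINT w|unit_square. ?F (lattice_coords w)) =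
      (LINT w|unit_square. a * (triangle_sign w * cnj (lattice_character k w)) + b * lattice_character (- k) w)"
    unfolding exp_lattice_frequency
    by (intro Bochner_Integration.integral_cong refl)
      (simp add: indicator_S_set_lattice_coords triangle_sign_def algebra_simps flip: cnj_lattice_character)
  also have "\<dots> = (LINT w|unit_square. a * (triangle_sign w * cnj (lattice_character k w)))
      + (LINT w|unit_square. b * lattice_character (- k) w)"
    by (intro Bochner_Integration.integral_add integrable_mult_right integrable_unit_square_bounded[where B = 1])
      (simp_all add: norm_mult)
  also have "\<dots> = a * triangle_coeff k + b * of_bool (k = 0)"
    by (simp add: integral_triangle_sign_mult_cnj integral_lattice_character)
  finally show ?thesis
    by (simp add: fourier_coeff_def measure_period_cell)
qed

text \<open>After the multiplier acts, the partial sum is that of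
  \<open>a * (indicator S_set z - 1 / 2)\<close> itself, with \<open>b\<close> gone. The distance is
  therefore the one on the unit square, times the Jacobian 2.\<close>

lemma L2_dist_S_set_partial_sum:
  assumes "finite K"
  shows "(\<integral>\<^sup>+z \<in> period_cell u_shift v_shift. ennreal ((cmod (a * (indicator S_set z - 1 / 2)
        - (\<Sum>\<omega>\<in>lattice_frequency ` K. of_real (double_hilbert_symbol \<omega>)
          * fourier_coeff u_shift v_shift (\<lambda>z. a * (indicator S_set z - 1 / 2) + b) \<omega>
          * exp (\<i> * of_real (\<omega> \<bullet> z)))))\<^sup>2) \<partial>lebesgue) =
    2 * ennreal ((cmod a)\<^sup>2 * (1 / 4 - (\<Sum>k\<in>K. (cmod (triangle_coeff k))\<^sup>2)))"
proof -
  have sum_eq: "(\<Sum>\<omega>\<in>lattice_frequency ` K. of_real (double_hilbert_symbol \<omega>)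
          * fourier_coeff u_shift v_shift (\<lambda>z. a * (indicator S_set z - 1 / 2) + b) \<omega>
          * exp (\<i> * of_real (\<omega> \<bullet> z))) =
      (\<Sum>k\<in>K. a * triangle_coeff k * exp (\<i> * of_real (lattice_frequency k \<bullet> z)))" for z
    by (subst sum.reindex) (simp_all add: inj_on_subset[OF inj_lattice_frequency] fourier_coeff_S_set
        symbol_mult_triangle_coeff)
  have "(\<integral>\<^sup>+z \<in> period_cell u_shift v_shift. ennreal ((cmod (a * (indicator S_set z - 1 / 2)
        - (\<Sum>k\<in>K. a * triangle_coeff k * exp (\<i> * of_real (lattice_frequency k \<bullet> z)))))\<^sup>2) \<partial>lebesgue) =
    2 * (\<integral>\<^sup>+w. ennreal ((cmod (a * (indicator S_set (lattice_coords w) - 1 / 2)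
        - (\<Sum>k\<in>K. a * triangle_coeff k * exp (\<i> * of_real (lattice_frequency k \<bullet> lattice_coords w)))))\<^sup>2)
      \<partial>unit_square)"
    by (rule nn_integral_period_cell) measurable
  also have "(\<integral>\<^sup>+w. ennreal ((cmod (a * (indicator S_set (lattice_coords w) - 1 / 2)
        - (\<Sum>k\<in>K. a * triangle_coeff k * exp (\<i> * of_real (lattice_frequency k \<bullet> lattice_coords w)))))\<^sup>2)
      \<partial>unit_square) = (\<integral>\<^sup>+w. ennreal ((cmod (a * triangle_sign w
        - (\<Sum>k\<in>K. a * triangle_coeff k * lattice_character k w)))\<^sup>2) \<partial>unit_square)"
    unfolding exp_lattice_frequency
    by (rule nn_integral_cong) (simp add: indicator_S_set_lattice_coords triangle_sign_def)
  also have "\<dots> = ennreal ((cmod a)\<^sup>2 * (1 / 4 - (\<Sum>k\<in>K. (cmod (triangle_coeff k))\<^sup>2)))"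
    by (rule L2_dist_triangle_sign_partial_sum) fact
  finally show ?thesis
    unfolding sum_eq .
qed

text \<open>The squared distance tends to 0 by the Parseval sum. The choice \<open>a = 1\<close>,
  \<open>b = 1/2\<close> gives the indicator of \<open>S_set\<close>, and \<open>a = 2\<close>,
  \<open>b = 0\<close> gives the function with values 1 and -1.\<close>

lemma has_double_hilbert_S_set:
  "has_double_hilbert u_shift v_shift (\<lambda>z. a * (indicator S_set z - 1 / 2) + b)
     (\<lambda>z. a * (indicator S_set z - 1 / 2))"
  unfolding has_double_hilbert_def
proof (intro conjI)
  show "lattice_basis u_shift v_shift" by (rule lattice_basis_uv_shift)
  show "(\<lambda>z. a * (indicator S_set z - 1 / 2) + b) \<in> borel_measurable lebesgue"
    "(\<lambda>z. a * (indicator S_set z - 1 / 2)) \<in> borel_measurable lebesgue"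
    by (intro measurable_completion; measurable)+
  show "bounded (range (\<lambda>z. a * (indicator S_set z - 1 / 2) + b))"
    by (rule finite_imp_bounded, rule finite_subset[of _ "{a / 2 + b, - a / 2 + b}"])
      (auto simp: indicator_def)
  show "lattice_periodic u_shift v_shift (\<lambda>z. a * (indicator S_set z - 1 / 2) + b)"
    "lattice_periodic u_shift v_shift (\<lambda>z. a * (indicator S_set z - 1 / 2))"
    by (simp_all add: lattice_periodic_def indicator_S_set_periodic)
  have "((\<lambda>K. \<Sum>k\<in>K. (cmod (triangle_coeff k))\<^sup>2) \<longlongrightarrow> 1 / 4) (finite_subsets_at_top UNIV)"
    using has_sum_triangle_coeff_squares by (simp add: has_sum_def)
  then have "((\<lambda>K. 2 * ennreal ((cmod a)\<^sup>2 * (1 / 4 - (\<Sum>k\<in>K. (cmod (triangle_coeff k))\<^sup>2))))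
      \<longlongrightarrow> 2 * ennreal ((cmod a)\<^sup>2 * (1 / 4 - 1 / 4))) (finite_subsets_at_top UNIV)"
    by (intro tendsto_intros tendsto_ennrealI ennreal_tendsto_cmult) auto
  then have "((\<lambda>K. \<integral>\<^sup>+z \<in> period_cell u_shift v_shift. ennreal ((cmod (a * (indicator S_set z - 1 / 2)
        - (\<Sum>\<omega>\<in>lattice_frequency ` K. of_real (double_hilbert_symbol \<omega>)
          * fourier_coeff u_shift v_shift (\<lambda>z. a * (indicator S_set z - 1 / 2) + b) \<omega>
          * exp (\<i> * of_real (\<omega> \<bullet> z)))))\<^sup>2) \<partial>lebesgue) \<longlongrightarrow> 2 * ennreal ((cmod a)\<^sup>2 * (1 / 4 - 1 / 4)))
      (finite_subsets_at_top UNIV)"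
    by (rule Lim_transform_eventually)
      (intro eventually_finite_subsets_at_top_weakI L2_dist_S_set_partial_sum[symmetric])
  then show "((\<lambda>F. \<integral>\<^sup>+z \<in> period_cell u_shift v_shift. ennreal ((cmod (a * (indicator S_set z - 1 / 2)
        - (\<Sum>\<omega>\<in>F. of_real (double_hilbert_symbol \<omega>)
          * fourier_coeff u_shift v_shift (\<lambda>z. a * (indicator S_set z - 1 / 2) + b) \<omega>
          * exp (\<i> * of_real (\<omega> \<bullet> z)))))\<^sup>2) \<partial>lebesgue) \<longlongrightarrow> 0)
      (finite_subsets_at_top (frequencies u_shift v_shift))"
    \<comment> \<open>By injectivity the finite sets of frequencies are the images of the finite
      sets of integer pairs, so the limit over the latter is the limit over the former.\<close>
    unfolding frequencies_eq filtermap_image_finite_subsets_at_top[OF inj_lattice_frequency, symmetric]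
      filterlim_filtermap by simp
qed

theorem theorem5:
  "(AE z in lebesgue. (indicator S_set z :: real)
        = frac (u_coord z) + frac (v_coord z) - frac (u_coord z + v_coord z))
   \<and> (\<forall>a b. has_density {t. (a + t, b) \<in> S_set} (1 / 2))
   \<and> (\<forall>a b. has_density {t. (a, b + t) \<in> S_set} (1 / 2))
   \<and> has_double_hilbert u_shift v_shift
        (\<lambda>z. indicator S_set z) (\<lambda>z. indicator S_set z - 1 / 2)
   \<and> has_double_hilbert u_shift v_shift
        (\<lambda>z. 2 * indicator S_set z - 1) (\<lambda>z. 2 * indicator S_set z - 1)"
  using AE_indicator_S_set has_density_S_set_horizontal has_density_S_set_vertical
    has_double_hilbert_S_set[of 1 "1 / 2"] has_double_hilbert_S_set[of 2 0]
  by simp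

end
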